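(* Let $P\in\mathbb{Z}[x]$. Then $\mathbb{Z}[x]=\mathcal{N}[x]+(P)$ holds for some finite set $\mathcal{N}\subset\mathbb{Z}$ if and only if $P$ has no complex root $\alpha$ with $|\alpha|<1$.
   Context: For a finite set $\mathcal{N}\subset\mathbb{Z}$, $\mathcal{N}[x]:=\{d_0+d_1x+\dots+d_kx^k : k\ge 0,\ d_j\in\mathcal{N}\}$ denotes the set of polynomials all of whose coefficients lie in $\mathcal{N}$. For $P\in\mathbb{Z}[x]$, $(P)$ denotes the principal ideal of $\mathbb{Z}[x]$ generated by $P$, and $\mathcal{N}[x]+(P)=\{R+S : R\in\mathcal{N}[x], S\in(P)\}$. *)

theory Defs
  imports Complex_Main "HOL-Computational_Algebra.Polynomial" "HOL-Library.Set_Algebras"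
begin

(* As the digit set need not contain 0, the number of coefficients is an explicit k + 1
   rather than read off from the degree. *)
definition polys_over :: "int set \<Rightarrow> int poly set" where
  "polys_over N = {\<Sum>j\<le>k. monom (d j) j | (k::nat) (d::nat \<Rightarrow> int). \<forall>j\<le>k. d j \<in> N}"

definition principal_ideal :: "int poly \<Rightarrow> int poly set" where
  "principal_ideal P = {Q * P | Q. True}"

end

theory Submission
  imports Defs "HOL-Computational_Algebra.Fundamental_Theorem_Algebra"
begin

text \<open>
  If \<open>a\<close> is a root with \<open>|a| < 1\<close>, the values at \<open>a\<close> of polynomials with coefficients in a finite set
  are bounded by a geometric series, whereas the integers are not bounded.

  Conversely, call \<open>P\<close> height reducible if every integer polynomial is congruent modulo \<open>P\<close> to one
  with coefficients bounded by a constant \<open>H\<close>. This property passes to products (reduce modulo \<open>P\<close>,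
  then reduce the quotient modulo \<open>Q\<close>) and to divisors. If \<open>P\<close> has a multiple complex root, an
  integer polynomial of least degree vanishing there splits a constant multiple of \<open>P\<close> into factors of
  smaller degree, so one may assume that the roots are simple. Now divide repeatedly:
  \<open>B = d + x B' + q P\<close>, where the digit \<open>d\<close> is determined modulo \<open>P(0)\<close>. All roots satisfy \<open>|a| \<ge> 1\<close>,
  so \<open>\<Sum>|B'(a)|\<^sup>2 \<le> \<Sum>|B(a) - d|\<^sup>2\<close>, and with \<open>d\<close> of the sign of the trace \<open>\<Sum>B(a)\<close> this is
  at most \<open>\<Sum>|B(a)|\<^sup>2 - |\<Sum>B(a)| + c\<close>. During \<open>deg P\<close> successive steps the traces are, up to a bounded
  error, the moments \<open>\<Sum>B(a) a\<^sup>-\<^sup>k\<close>, which by Lagrange interpolation cannot all be small when some \<open>B(a)\<close>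
  is large. Hence \<open>\<Sum>|B(a)|\<^sup>2\<close> descends below an absolute bound, and so do the coefficients of \<open>B\<close>.
\<close>

section \<open>Evaluation of integer polynomials at complex points\<close>

definition ceval :: "int poly \<Rightarrow> complex \<Rightarrow> complex" where
  "ceval B a = poly (map_poly of_int B) a"

lemma ceval_0 [simp]: "ceval 0 a = 0"
  by (simp add: ceval_def)

lemma ceval_pCons [simp]: "ceval (pCons c B) a = of_int c + a * ceval B a"
  by (simp add: ceval_def map_poly_pCons)

lemma ceval_add [simp]: "ceval (A + B) a = ceval A a + ceval B a"
proof -
  have "map_poly complex_of_int (A + B) = map_poly of_int A + map_poly of_int B"
    by (intro poly_eqI) (simp add: coeff_map_poly)
  then show ?thesis by (simp add: ceval_def)
qed

lemma ceval_smult [simp]: "ceval (smult c B) a = of_int c * ceval B a"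
proof -
  have "map_poly complex_of_int (smult c B) = smult (of_int c) (map_poly of_int B)"
    by (intro poly_eqI) (simp add: coeff_map_poly)
  then show ?thesis by (simp add: ceval_def)
qed

lemma ceval_mult [simp]: "ceval (A * B) a = ceval A a * ceval B a"
  by (induction A) (simp_all add: algebra_simps)

lemma ceval_sum: "ceval (sum f I) a = (\<Sum>i\<in>I. ceval (f i) a)"
  by (induction I rule: infinite_finite_induct) simp_all

lemma ceval_monom: "ceval (monom c j) a = of_int c * a ^ j"
  by (simp add: ceval_def map_poly_monom poly_monom)

lemma ceval_cnj: "ceval B (cnj a) = cnj (ceval B a)"
  by (induction B) simp_all

lemma map_poly_of_int_eq_0_iff:
  "map_poly (of_int :: int \<Rightarrow> complex) P = 0 \<longleftrightarrow> P = 0"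
  by (simp add: poly_eq_iff coeff_map_poly)

lemma degree_map_poly_of_int: "degree (map_poly (of_int :: int \<Rightarrow> complex) P) = degree P"
  by (rule degree_map_poly) simp

lemma pderiv_map_poly_of_int:
  "pderiv (map_poly (of_int :: int \<Rightarrow> complex) P) = map_poly of_int (pderiv P)"
  by (intro poly_eqI) (simp add: coeff_pderiv coeff_map_poly)

section \<open>Height reducibility and its relation to finite digit sets\<close>

text \<open>The bound \<open>H\<close> is uniform in \<open>A\<close>, while the degree of
  \<open>B\<close> stays unrestricted.\<close>

definition height_reducible :: "int poly \<Rightarrow> bool" where
  "height_reducible P \<longleftrightarrow> (\<exists>H. \<forall>A. \<exists>B. P dvd (A - B) \<and> (\<forall>k. \<bar>coeff B k\<bar> \<le> H))"

text \<open>Only the coefficients of \<open>P\<close> up to its degree contribute to the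
  convolution, so the bound is independent of the degree of \<open>B\<close>.\<close>

lemma coeff_mult_bound:
  fixes P B :: "int poly"
  assumes "\<And>k. \<bar>coeff B k\<bar> \<le> H"
  shows "\<bar>coeff (P * B) k\<bar> \<le> (\<Sum>i\<le>degree P. \<bar>coeff P i\<bar>) * H"
proof -
  have H: "0 \<le> H" using assms[of 0] by linarith
  have "\<bar>coeff (P * B) k\<bar> \<le> (\<Sum>i\<le>k. \<bar>coeff P i\<bar> * \<bar>coeff B (k - i)\<bar>)"
    unfolding coeff_mult by (rule order_trans[OF sum_abs]) (simp add: abs_mult)
  also have "\<dots> \<le> (\<Sum>i\<le>k. \<bar>coeff P i\<bar> * H)"
    by (intro sum_mono mult_left_mono assms) simp
  also have "\<dots> \<le> (\<Sum>i\<le>max k (degree P). \<bar>coeff P i\<bar> * H)"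
    by (rule sum_mono2) (auto simp: H)
  also have "\<dots> = (\<Sum>i\<le>degree P. \<bar>coeff P i\<bar> * H)"
    by (rule sum.mono_neutral_right) (auto simp: coeff_eq_0)
  finally show ?thesis by (simp add: sum_distrib_right)
qed

lemma height_reducible_mult:
  assumes "height_reducible P" "height_reducible Q"
  shows "height_reducible (P * Q)"
proof -
  obtain H where H: "\<And>A. \<exists>B. P dvd (A - B) \<and> (\<forall>k. \<bar>coeff B k\<bar> \<le> H)"
    using assms(1) unfolding height_reducible_def by blast
  obtain K where K: "\<And>A. \<exists>B. Q dvd (A - B) \<and> (\<forall>k. \<bar>coeff B k\<bar> \<le> K)"
    using assms(2) unfolding height_reducible_def by blast
  have "\<exists>B. P * Q dvd (A - B) \<and>
      (\<forall>k. \<bar>coeff B k\<bar> \<le> H + (\<Sum>i\<le>degree P. \<bar>coeff P i\<bar>) * K)" for A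
  proof -
    obtain R where R: "P dvd (A - R)" "\<And>k. \<bar>coeff R k\<bar> \<le> H" using H by blast
    then obtain S where S: "A - R = P * S" by (elim dvdE)
    obtain T where T: "Q dvd (S - T)" "\<And>k. \<bar>coeff T k\<bar> \<le> K" using K by blast
    have "A - (R + P * T) = P * (S - T)" using S by (simp add: algebra_simps)
    then have "P * Q dvd (A - (R + P * T))" using T(1) by (simp add: mult_dvd_mono)
    moreover have "\<bar>coeff (R + P * T) k\<bar> \<le> H + (\<Sum>i\<le>degree P. \<bar>coeff P i\<bar>) * K" for k
      using R(2)[of k] coeff_mult_bound[OF T(2), of P k] by simp
    ultimately show ?thesis by blast
  qed
  then show ?thesis unfolding height_reducible_def by blast
qed

lemma height_reducible_dvd:
  assumes "height_reducible Q" "P dvd Q"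
  shows "height_reducible P"
  using assms unfolding height_reducible_def by (meson dvd_trans)

lemma height_reducible_imp_polys_over:
  assumes "height_reducible P"
  shows "\<exists>N. finite N \<and> (UNIV :: int poly set) = polys_over N + principal_ideal P"
proof -
  obtain H where H: "\<And>A. \<exists>B. P dvd (A - B) \<and> (\<forall>k. \<bar>coeff B k\<bar> \<le> H)"
    using assms unfolding height_reducible_def by blast
  have "A \<in> polys_over {- H..H} + principal_ideal P" for A
  proof -
    obtain B where B: "P dvd (A - B)" "\<And>k. \<bar>coeff B k\<bar> \<le> H" using H by blast
    have "coeff B j \<in> {- H..H}" for j using B(2)[of j] by auto
    then have "(\<Sum>j\<le>degree B. monom (coeff B j) j) \<in> polys_over {- H..H}"
      unfolding polys_over_def by blast
    then have "B \<in> polys_over {- H..H}" by (simp add: poly_as_sum_of_monoms)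
    moreover have "A - B \<in> principal_ideal P"
      using B(1) unfolding principal_ideal_def by (auto simp: dvd_def mult.commute)
    ultimately have "B + (A - B) \<in> polys_over {- H..H} + principal_ideal P"
      by (rule set_plus_intro)
    then show ?thesis by simp
  qed
  then show ?thesis by (intro exI[of _ "{- H..H}"]) auto
qed

section \<open>Necessity: a root in the open unit disc is impossible\<close>

lemma polys_over_imp_no_small_root:
  assumes N: "finite N" "(UNIV :: int poly set) = polys_over N + principal_ideal P"
    and root: "ceval P a = 0" and small: "cmod a < 1"
  shows False
proof -
  obtain M where M: "\<And>d. d \<in> N \<Longrightarrow> real_of_int \<bar>d\<bar> \<le> M" "0 \<le> M"
  proof
    show "real_of_int \<bar>d\<bar> \<le> (\<Sum>d\<in>N. real_of_int \<bar>d\<bar>)" if "d \<in> N" for d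
      using that N(1) by (intro member_le_sum) auto
  qed (simp add: sum_nonneg)
  \<comment> \<open>The quotient is the sum of the full geometric series with leading term
    \<open>M\<close>; \<open>m\<close> is an integer beyond it.\<close>
  obtain m :: nat where m: "M / (1 - cmod a) < real m" using reals_Archimedean2 by blast
  have "[:int m:] \<in> polys_over N + principal_ideal P" using N(2) by blast
  then obtain k d Q where d: "\<forall>j\<le>k. d j \<in> N"
    and eq: "[:int m:] = (\<Sum>j\<le>(k::nat). monom (d j) j) + Q * P"
    unfolding set_plus_def polys_over_def principal_ideal_def by blast
  \<comment> \<open>Evaluation at the root kills the multiple of \<open>P\<close>.\<close>
  have "of_nat m = (\<Sum>j\<le>k. of_int (d j) * a ^ j)"
    using arg_cong[OF eq, of "\<lambda>B. ceval B a"] by (simp add: root ceval_sum ceval_monom)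
  then have "real m = cmod (\<Sum>j\<le>k. of_int (d j) * a ^ j)" by (metis norm_of_nat)
  also have "\<dots> \<le> (\<Sum>j\<le>k. M * cmod a ^ j)"
    using d M(1) by (intro sum_norm_le) (auto simp: norm_mult norm_power intro!: mult_right_mono)
  also have "\<dots> = M * (\<Sum>j\<le>k. cmod a ^ j)" by (simp add: sum_distrib_left)
  finally have "real m * (1 - cmod a) \<le> M * ((1 - cmod a) * (\<Sum>j\<le>k. cmod a ^ j))"
    using small by (simp add: mult.commute mult.left_commute)
  \<comment> \<open>The product telescopes to one minus a power of \<open>cmod a\<close>.\<close>
  also have "\<dots> \<le> M * 1"
    using M(2) by (intro mult_left_mono) (simp_all only: sum_gp_basic, simp)
  finally show False using m small by (simp add: field_simps)
qed

section \<open>Estimates from Lagrange interpolation\<close>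

lemma lagrange_basis:
  fixes X :: "complex set"
  assumes "finite X" "a \<in> X"
  shows "\<exists>l. degree l < card X \<and> (\<forall>b\<in>X. poly l b = (if b = a then 1 else 0))"
proof -
  define L where "L = (\<Prod>b\<in>X - {a}. [:- b, 1:])"
  have "degree L \<le> (\<Sum>b\<in>X - {a}. degree [:- b, 1:])"
    unfolding L_def using degree_prod_sum_le[of "X - {a}" "\<lambda>b. [:- b, 1:]"] assms
    by (simp add: o_def)
  then have deg: "degree L < card X" using assms card_gt_0_iff[of X] by auto
  have val: "poly L b = (\<Prod>c\<in>X - {a}. b - c)" for b by (simp add: L_def poly_prod)
  have "poly L a \<noteq> 0" unfolding val using assms by simp
  moreover have "poly L b = 0" if "b \<in> X" "b \<noteq> a" for b
    unfolding val using assms that by auto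
  ultimately show ?thesis using deg by (intro exI[of _ "smult (inverse (poly L a)) L"]) auto
qed

text \<open>If \<open>l\<close> is the Lagrange basis polynomial at \<open>f a\<close>, the
  combination of the moments with the coefficients of \<open>l\<close> isolates \<open>z a\<close>.
  The constant depends on \<open>X\<close> and \<open>f\<close> but not on \<open>z\<close>.\<close>

lemma moments_bound:
  fixes f :: "complex \<Rightarrow> complex"
  assumes "finite X" "inj_on f X"
  shows "\<exists>C>0. \<forall>z. \<forall>a\<in>X. cmod (z a) \<le> C * (\<Sum>k<card X. cmod (\<Sum>b\<in>X. z b * f b ^ k))"
proof -
  have card: "card (f ` X) = card X" using assms by (simp add: card_image)
  have "\<exists>l. degree l < card X \<and> (\<forall>b\<in>X. poly l (f b) = (if b = a then 1 else 0))" if a: "a \<in> X" for a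
  proof -
    obtain l where "degree l < card (f ` X)" "\<forall>b\<in>f ` X. poly l b = (if b = f a then 1 else 0)"
      using lagrange_basis[of "f ` X" "f a"] assms(1) a by blast
    then show ?thesis using assms(2) a card by (intro exI[of _ l]) (auto simp: inj_on_eq_iff)
  qed
  then obtain l where l: "\<And>a. a \<in> X \<Longrightarrow> degree (l a) < card X"
    "\<And>a b. a \<in> X \<Longrightarrow> b \<in> X \<Longrightarrow> poly (l a) (f b) = (if b = a then 1 else 0)"
    by metis
  \<comment> \<open>The summand 1 makes \<open>C\<close> positive even for empty
    \<open>X\<close>.\<close>
  define C where "C = 1 + (\<Sum>a\<in>X. \<Sum>k<card X. cmod (coeff (l a) k))"
  show ?thesis
  proof (intro exI[of _ C] conjI allI ballI)
    show "C > 0" unfolding C_def by (intro add_pos_nonneg sum_nonneg) auto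
  next
    fix z a assume a: "a \<in> X"
    let ?m = "\<lambda>k. \<Sum>b\<in>X. z b * f b ^ k"
    have ev: "poly (l a) x = (\<Sum>k<card X. coeff (l a) k * x ^ k)" for x
      unfolding poly_altdef using l(1)[OF a]
      by (intro sum.mono_neutral_left) (auto simp: coeff_eq_0)
    have "z a = (\<Sum>b\<in>X. if b = a then z b else 0)" using a assms(1) by simp
    also have "\<dots> = (\<Sum>b\<in>X. z b * poly (l a) (f b))"
      by (intro sum.cong refl) (simp add: l(2)[OF a])
    also have "\<dots> = (\<Sum>b\<in>X. \<Sum>k<card X. coeff (l a) k * (z b * f b ^ k))"
      by (simp add: ev sum_distrib_left algebra_simps)
    also have "\<dots> = (\<Sum>k<card X. coeff (l a) k * ?m k)"
      by (subst sum.swap) (simp add: sum_distrib_left)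
    finally have "cmod (z a) = cmod (\<Sum>k<card X. coeff (l a) k * ?m k)" by simp
    also have "\<dots> \<le> (\<Sum>k<card X. C * cmod (?m k))"
    proof (rule sum_norm_le)
      fix k assume k: "k \<in> {..<card X}"
      have "cmod (coeff (l a) k) \<le> (\<Sum>k<card X. cmod (coeff (l a) k))"
        using k by (intro member_le_sum) auto
      also have "\<dots> \<le> (\<Sum>a\<in>X. \<Sum>k<card X. cmod (coeff (l a) k))"
        using a assms(1) by (intro member_le_sum[of a X "\<lambda>a. \<Sum>k<card X. cmod (coeff (l a) k)"])
          (auto intro: sum_nonneg)
      finally have "cmod (coeff (l a) k) \<le> C" by (simp add: C_def)
      then show "cmod (coeff (l a) k * ?m k) \<le> C * cmod (?m k)"
        unfolding norm_mult by (rule mult_right_mono) simp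
    qed
    finally show "cmod (z a) \<le> C * (\<Sum>k<card X. cmod (?m k))" by (simp add: sum_distrib_left)
  qed
qed

text \<open>A polynomial of degree below \<open>card X\<close> is the Lagrange interpolant of its
  values on \<open>X\<close>. Stating the restriction through coefficients covers empty
  \<open>X\<close>, where it forces \<open>B = 0\<close>.\<close>

lemma coeff_bound_by_values:
  fixes X :: "complex set"
  assumes "finite X"
  shows "\<exists>C\<ge>0. \<forall>B. (\<forall>j\<ge>card X. coeff B j = 0) \<longrightarrow>
    (\<forall>k. cmod (coeff B k) \<le> C * (\<Sum>a\<in>X. cmod (poly B a)))"
proof -
  obtain l where l: "\<And>a. a \<in> X \<Longrightarrow> degree (l a) < card X"
    "\<And>a b. a \<in> X \<Longrightarrow> b \<in> X \<Longrightarrow> poly (l a) b = (if b = a then 1 else 0)"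
    using lagrange_basis[OF assms] by metis
  define C where "C = (\<Sum>a\<in>X. \<Sum>k<card X. cmod (coeff (l a) k))"
  show ?thesis
  proof (intro exI[of _ C] conjI allI impI)
    show C: "C \<ge> 0" unfolding C_def by (intro sum_nonneg) auto
    fix B :: "complex poly" and k
    assume B: "\<forall>j\<ge>card X. coeff B j = 0"
    show "cmod (coeff B k) \<le> C * (\<Sum>a\<in>X. cmod (poly B a))"
    proof (cases "k < card X")
      case False
      then show ?thesis using B C by (simp add: sum_nonneg)
    next
      case True
      have "B = (\<Sum>a\<in>X. smult (poly B a) (l a))" (is "_ = ?R")
      proof (rule poly_eqI_degree)
        show "poly B x = poly ?R x" if "x \<in> X" for x
        proof -
          have "poly ?R x = (\<Sum>a\<in>X. if x = a then poly B a else 0)"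
            unfolding poly_sum using that by (intro sum.cong refl) (simp add: l(2))
          then show ?thesis using that assms by simp
        qed
        have pos: "0 < card X" using True by simp
        show "degree B < card X" using B pos by (metis coeff_0 leading_coeff_0_iff degree_0 not_le)
        show "degree ?R < card X"
          using pos l(1) by (intro degree_sum_less) (auto intro: le_less_trans[OF degree_smult_le])
      qed
      then have "coeff B k = (\<Sum>a\<in>X. poly B a * coeff (l a) k)"
        by (metis (no_types, lifting) coeff_smult coeff_sum sum.cong)
      also have "cmod \<dots> \<le> (\<Sum>a\<in>X. C * cmod (poly B a))"
      proof (rule sum_norm_le)
        fix a assume a: "a \<in> X"
        have "cmod (coeff (l a) k) \<le> (\<Sum>k<card X. cmod (coeff (l a) k))"
          using True by (intro member_le_sum) auto
        also have "\<dots> \<le> C" unfolding C_def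
          using a assms by (intro member_le_sum[of a X "\<lambda>a. \<Sum>k<card X. cmod (coeff (l a) k)"])
            (auto intro: sum_nonneg)
        finally show "cmod (poly B a * coeff (l a) k) \<le> C * cmod (poly B a)"
          unfolding norm_mult by (subst mult.commute) (rule mult_right_mono, simp_all)
      qed
      finally show ?thesis by (simp add: sum_distrib_left)
    qed
  qed
qed

section \<open>Digit expansions modulo a polynomial with simple roots\<close>

text \<open>Simplicity of the roots is expressed by \<open>card_X\<close>: there are as many
  distinct roots as the degree allows. Nonzero constants are included, with \<open>X\<close>
  empty.\<close>

locale simple_roots =
  fixes P :: "int poly" and X :: "complex set"
  assumes P_nonzero: "P \<noteq> 0"
    and X_def: "X = {a. ceval P a = 0}"
    and card_X: "card X = degree P"
    and X_ge_1: "a \<in> X \<Longrightarrow> 1 \<le> cmod a"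
begin

definition p :: int where "p = \<bar>coeff P 0\<bar>"

text \<open>The Lyapunov function of the descent. With squares, subtracting a digit changes it by a
  term linear in the trace plus a constant.\<close>

definition lyap :: "int poly \<Rightarrow> real" where "lyap B = (\<Sum>a\<in>X. (cmod (ceval B a))\<^sup>2)"

definition tr :: "int poly \<Rightarrow> complex" where "tr B = (\<Sum>a\<in>X. ceval B a)"

text \<open>This models \<open>k\<close> division steps from \<open>B\<close> to \<open>B'\<close>,
  with the emitted digits collected in \<open>R\<close>. Confining \<open>R\<close> to positions
  below \<open>k\<close> keeps the digits of consecutive runs apart.\<close>

definition reaches :: "nat \<Rightarrow> int poly \<Rightarrow> int poly \<Rightarrow> bool" where
  "reaches k B B' \<longleftrightarrow> (\<exists>R. P dvd (B - (R + monom 1 k * B')) \<and>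
     (\<forall>j. \<bar>coeff R j\<bar> \<le> 2 * p) \<and> (\<forall>j\<ge>k. coeff R j = 0))"

lemma finite_X: "finite X"
  using poly_roots_finite[of "map_poly complex_of_int P"] P_nonzero
  by (simp add: X_def ceval_def map_poly_of_int_eq_0_iff)

lemma p_ge_1: "p \<ge> 1"
proof -
  have "0 \<notin> X" using X_ge_1 by force
  then have "coeff P 0 \<noteq> 0"
    by (simp add: X_def ceval_def poly_0_coeff_0 coeff_map_poly)
  then show ?thesis by (simp add: p_def)
qed

lemma reaches_refl: "reaches 0 B B"
  unfolding reaches_def using p_ge_1 by (intro exI[of _ 0]) simp

lemma reaches_trans:
  assumes "reaches k A B" "reaches l B C"
  shows "reaches (k + l) A C"
proof -
  obtain R where R: "P dvd (A - (R + monom 1 k * B))" "\<And>j. \<bar>coeff R j\<bar> \<le> 2 * p"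
    "\<And>j. j \<ge> k \<Longrightarrow> coeff R j = 0"
    using assms(1) unfolding reaches_def by blast
  obtain S where S: "P dvd (B - (S + monom 1 l * C))" "\<And>j. \<bar>coeff S j\<bar> \<le> 2 * p"
    "\<And>j. j \<ge> l \<Longrightarrow> coeff S j = 0"
    using assms(2) unfolding reaches_def by blast
  have "A - ((R + monom 1 k * S) + monom 1 (k + l) * C)
      = (A - (R + monom 1 k * B)) + monom 1 k * (B - (S + monom 1 l * C))"
    by (simp add: algebra_simps mult_monom flip: mult.assoc)
  then have "P dvd (A - ((R + monom 1 k * S) + monom 1 (k + l) * C))"
    using R(1) S(1) by (metis dvd_add dvd_mult)
  \<comment> \<open>At each position at most one of the two summands is nonzero, so the bounds do
    not add up.\<close>
  moreover have "\<bar>coeff (R + monom 1 k * S) j\<bar> \<le> 2 * p" for j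
    using R(2)[of j] R(3)[of j] S(2)[of "j - k"] p_ge_1 by (simp add: coeff_monom_mult)
  moreover have "coeff (R + monom 1 k * S) j = 0" if "j \<ge> k + l" for j
    using R(3)[of j] S(3)[of "j - k"] that by (simp add: coeff_monom_mult)
  ultimately show ?thesis unfolding reaches_def by blast
qed

text \<open>Conjugation permutes the roots of an integer polynomial.\<close>

lemma tr_real: "tr B = of_real (Re (tr B))"
proof -
  have "bij_betw cnj X X"
    by (rule bij_betw_byWitness[of _ cnj]) (auto simp: X_def ceval_cnj)
  then have "tr B = (\<Sum>a\<in>X. ceval B (cnj a))"
    unfolding tr_def by (rule sum.reindex_bij_betw[symmetric])
  then have "cnj (tr B) = tr B" by (simp add: ceval_cnj tr_def)
  then show ?thesis by (simp add: complex_eq_iff)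
qed

lemma division_step:
  "\<exists>d B' q. B = pCons d B' + smult q P \<and> \<bar>d\<bar> \<le> 2 * p \<and>
     lyap B' \<le> lyap B - cmod (tr B) + 4 * card X * p\<^sup>2"
proof -
  define s :: int where "s = (if Re (tr B) \<ge> 0 then 1 else -1)"
  define b where "b = coeff B 0"
  \<comment> \<open>This is the representative of \<open>b\<close> modulo \<open>p\<close> that has
    the sign \<open>s\<close> of the trace and absolute value at least \<open>p\<close>; the added
    \<open>p\<close> keeps it away from 0.\<close>
  define d where "d = s * (p + (s * b) mod p)"
  have s: "s * s = 1" "s = 1 \<or> s = -1" by (auto simp: s_def)
  have sd: "p \<le> s * d" "s * d \<le> 2 * p"
    using p_ge_1 pos_mod_bound[of p "s * b"]
    unfolding d_def mult.assoc[symmetric] s(1) by (auto intro: order_less_imp_le)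
  have d_le: "\<bar>d\<bar> \<le> 2 * p" using sd s(2) p_ge_1 by auto
  have "b - d = s * (s * b - (s * b) mod p - p)"
    unfolding d_def using s by (auto simp: algebra_simps)
  moreover have "p dvd s * b - (s * b) mod p - p" by (simp add: dvd_minus_mod)
  ultimately have "p dvd b - d" by simp
  then have "coeff P 0 dvd b - d" by (simp add: p_def)
  then obtain q where q: "b - d = coeff P 0 * q" by (elim dvdE)
  obtain d' B' where B': "B - smult q P = pCons d' B'" by (rule pCons_cases)
  have "d' = d" using arg_cong[OF B', of "\<lambda>B. coeff B 0"] q by (simp add: b_def algebra_simps)
  then have B: "B = pCons d B' + smult q P" using B' by (simp add: algebra_simps)
  \<comment> \<open>At a root, \<open>B - d\<close> takes the value \<open>a * B'(a)\<close>, and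
    dividing by \<open>a\<close> does not increase the modulus.\<close>
  have "lyap B' \<le> (\<Sum>a\<in>X. (cmod (ceval B a - of_int d))\<^sup>2)"
    unfolding lyap_def
  proof (rule sum_mono)
    fix a assume a: "a \<in> X"
    then have "ceval B a - of_int d = a * ceval B' a" by (simp add: B X_def)
    then have "cmod (ceval B a - of_int d) = cmod a * cmod (ceval B' a)" by (simp add: norm_mult)
    moreover have "1 * cmod (ceval B' a) \<le> cmod a * cmod (ceval B' a)"
      using X_ge_1[OF a] by (rule mult_right_mono) simp
    ultimately show "(cmod (ceval B' a))\<^sup>2 \<le> (cmod (ceval B a - of_int d))\<^sup>2"
      by (intro power_mono) auto
  qed
  also have "\<dots> = (\<Sum>a\<in>X. (cmod (ceval B a))\<^sup>2 - 2 * real_of_int d * Re (ceval B a) + (real_of_int d)\<^sup>2)"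
    by (intro sum.cong refl) (simp add: cmod_power2 power2_diff algebra_simps)
  also have "\<dots> = lyap B - 2 * (real_of_int d * Re (tr B)) + card X * (real_of_int d)\<^sup>2"
    by (simp add: lyap_def tr_def sum.distrib sum_subtractf sum_distrib_left algebra_simps)
  also have "\<dots> \<le> lyap B - cmod (tr B) + 4 * card X * p\<^sup>2"
  proof -
    have "cmod (tr B) = \<bar>Re (tr B)\<bar>" by (metis tr_real norm_of_real)
    also have "\<dots> = s * Re (tr B)" by (simp add: s_def)
    finally have tr: "cmod (tr B) = s * Re (tr B)" .
    \<comment> \<open>The factor \<open>s * s = 1\<close> is split: one sign makes \<open>d\<close>
      positive, the other turns the trace into its modulus.\<close>
    have "real_of_int d * Re (tr B) = real_of_int (s * s) * (real_of_int d * Re (tr B))"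
      by (simp add: s(1) del: of_int_mult)
    also have "\<dots> = real_of_int (s * d) * cmod (tr B)" by (simp add: tr)
    finally have "real_of_int d * Re (tr B) = real_of_int (s * d) * cmod (tr B)" .
    moreover have "1 * cmod (tr B) \<le> real_of_int (s * d) * cmod (tr B)"
      using sd p_ge_1 by (intro mult_right_mono norm_ge_zero) linarith
    ultimately have 1: "cmod (tr B) \<le> 2 * (real_of_int d * Re (tr B))"
      using norm_ge_zero[of "tr B"] by linarith
    have "\<bar>real_of_int d\<bar> \<le> 2 * real_of_int p" using d_le by linarith
    then have "(real_of_int d)\<^sup>2 \<le> (2 * real_of_int p)\<^sup>2"
      by (metis abs_ge_zero power2_abs power_mono)
    then have "card X * (real_of_int d)\<^sup>2 \<le> card X * (4 * (real_of_int p)\<^sup>2)"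
      by (intro mult_left_mono) (auto simp: power_mult_distrib)
    with 1 show ?thesis by simp
  qed
  finally show ?thesis using B d_le by blast
qed

text \<open>Choosing digit and successor as functions allows the step to be iterated. The last
  property holds because \<open>P\<close> has no coefficient above its degree, so there the step is
  a plain shift.\<close>

lemma division_step_functions:
  obtains dig nxt where
    "\<And>B. reaches 1 B (nxt B)"
    "\<And>B. \<bar>dig B\<bar> \<le> 2 * p"
    "\<And>B. lyap (nxt B) \<le> lyap B - cmod (tr B) + 4 * card X * p\<^sup>2"
    "\<And>B a. a \<in> X \<Longrightarrow> ceval (nxt B) a = (ceval B a - of_int (dig B)) / a"
    "\<And>B m. \<forall>j\<ge>Suc m. coeff B j = 0 \<Longrightarrow> degree P \<le> m \<Longrightarrow> \<forall>j\<ge>m. coeff (nxt B) j = 0"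
proof -
  obtain dig nxt quo where *: "\<And>B. B = pCons (dig B) (nxt B) + smult (quo B) P"
    "\<And>B. \<bar>dig B\<bar> \<le> 2 * p" "\<And>B. lyap (nxt B) \<le> lyap B - cmod (tr B) + 4 * card X * p\<^sup>2"
    using division_step by metis
  show ?thesis
  proof (rule that[of nxt dig])
    show "reaches 1 B (nxt B)" for B
      unfolding reaches_def
    proof (intro exI[of _ "[:dig B:]"] conjI allI impI)
      have "monom 1 1 * nxt B = pCons 0 (nxt B)" by (simp add: monom_altdef)
      then have "B - ([:dig B:] + monom 1 1 * nxt B) = smult (quo B) P"
        by (subst *(1)[of B]) simp
      then show "P dvd B - ([:dig B:] + monom 1 1 * nxt B)" by (simp add: dvd_smult)
    qed (use *(2)[of B] p_ge_1 in \<open>auto simp: coeff_pCons split: nat.splits\<close>)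
    show "ceval (nxt B) a = (ceval B a - of_int (dig B)) / a" if "a \<in> X" for a B
    proof -
      have "ceval B a = of_int (dig B) + a * ceval (nxt B) a"
        using that by (subst *(1)[of B]) (simp add: X_def)
      moreover have "a \<noteq> 0" using X_ge_1[OF that] by auto
      ultimately show ?thesis by simp
    qed
    show "\<forall>j\<ge>m. coeff (nxt B) j = 0"
      if "\<forall>j\<ge>Suc m. coeff B j = 0" "degree P \<le> m" for B m
    proof (intro allI impI)
      fix j assume "j \<ge> m"
      have "coeff B (Suc j) = coeff (nxt B) j + quo B * coeff P (Suc j)"
        by (subst *(1)[of B]) simp
      then show "coeff (nxt B) j = 0" using that \<open>j \<ge> m\<close> by (simp add: coeff_eq_0)
    qed
  qed (use * in auto)
qed

section \<open>Iterated division: reduction of the degree and descent\<close>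

lemma reduce_degree:
  "\<exists>k B'. reaches k B B' \<and> (\<forall>j\<ge>degree P. coeff B' j = 0)"
proof -
  obtain nxt where *: "\<And>B. reaches 1 B (nxt B)"
    "\<And>B m. \<forall>j\<ge>Suc m. coeff B j = 0 \<Longrightarrow> degree P \<le> m \<Longrightarrow> \<forall>j\<ge>m. coeff (nxt B) j = 0"
    using division_step_functions by metis
  have "\<exists>k B'. reaches k B B' \<and> (\<forall>j\<ge>degree P. coeff B' j = 0)"
    if "\<And>j. j \<ge> degree P + m \<Longrightarrow> coeff B j = 0" for m B
    using that
  proof (induction m arbitrary: B)
    case 0
    then show ?case using reaches_refl by (intro exI[of _ 0] exI[of _ B]) auto
  next
    case (Suc m)
    have "\<exists>k B'. reaches k (nxt B) B' \<and> (\<forall>j\<ge>degree P. coeff B' j = 0)"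
      using *(2)[of "degree P + m" B] Suc.prems by (intro Suc.IH) auto
    then show ?case using reaches_trans[OF *(1)] by blast
  qed
  from this[of "Suc (degree B)" B] show ?thesis by (simp add: coeff_eq_0)
qed

text \<open>One round consists of \<open>card X\<close> steps, as many as there are moments needed
  to detect a large value \<open>B(a)\<close>.\<close>

lemma lyap_decreases:
  obtains V where "\<And>B. (\<And>j. j \<ge> degree P \<Longrightarrow> coeff B j = 0) \<Longrightarrow> V < lyap B \<Longrightarrow>
    \<exists>k B'. reaches k B B' \<and> (\<forall>j\<ge>degree P. coeff B' j = 0) \<and> lyap B' \<le> lyap B - 1"
proof -
  obtain dig nxt where *: "\<And>B. reaches 1 B (nxt B)"
    "\<And>B. \<bar>dig B\<bar> \<le> 2 * p"
    "\<And>B. lyap (nxt B) \<le> lyap B - cmod (tr B) + 4 * card X * p\<^sup>2"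
    "\<And>B a. a \<in> X \<Longrightarrow> ceval (nxt B) a = (ceval B a - of_int (dig B)) / a"
    "\<And>B m. \<forall>j\<ge>Suc m. coeff B j = 0 \<Longrightarrow> degree P \<le> m \<Longrightarrow> \<forall>j\<ge>m. coeff (nxt B) j = 0"
    using division_step_functions by metis
  define n where "n = card X"
  have "inj_on inverse X" by (auto simp: inj_on_def)
  then obtain C where C: "C > 0"
    "\<forall>z. \<forall>a\<in>X. cmod (z a) \<le> C * (\<Sum>k<n. cmod (\<Sum>b\<in>X. z b * inverse b ^ k))"
    using moments_bound[OF finite_X] unfolding n_def by blast
  \<comment> \<open>The summands are the total error from replacing traces by moments, the total of
    the constants lost in \<open>n\<close> steps, and the desired decrease 1.\<close>
  define E where "E = n * (n * (2 * p * n)) + n * (4 * card X * p\<^sup>2) + (1::real)"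
  have E: "E \<ge> 1" unfolding E_def using p_ge_1 by simp
  show ?thesis
  proof (rule that[of "n * (C * E)\<^sup>2"])
    fix B assume low: "\<And>j. j \<ge> degree P \<Longrightarrow> coeff B j = 0" and big: "n * (C * E)\<^sup>2 < lyap B"
    define S where "S k = (nxt ^^ k) B" for k
    have S_Suc: "S (Suc k) = nxt (S k)" "S 0 = B" for k by (simp_all add: S_def)
    have reach: "reaches k B (S k)" for k
    proof (induction k)
      case (Suc k)
      show ?case using reaches_trans[OF Suc *(1)] by (simp add: S_Suc)
    qed (simp add: S_Suc reaches_refl)
    \<comment> \<open>A step preserves this bound, by the shift property at the boundary
      \<open>m = degree P\<close>.\<close>
    have low_S: "\<forall>j\<ge>degree P. coeff (S k) j = 0" for k
    proof (induction k)
      case (Suc k)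
      then show ?case using *(5)[of "degree P" "S k"] by (simp add: S_Suc)
    qed (simp add: S_Suc low)
    have lyap_S: "lyap (S k) \<le> lyap B - (\<Sum>i<k. cmod (tr (S i))) + k * (4 * card X * p\<^sup>2)" for k
    proof (induction k)
      case (Suc k)
      then show ?case using *(3)[of "S k"] by (simp add: S_Suc algebra_simps)
    qed (simp add: S_Suc)
    \<comment> \<open>Each step adds a digit to the deviation and divides by \<open>a\<close> with
      \<open>cmod a \<ge> 1\<close>, so the deviation grows by at most \<open>2 * p\<close>.\<close>
    have dev: "cmod (ceval (S k) a - ceval B a * inverse a ^ k) \<le> 2 * p * k" if a: "a \<in> X" for k a
    proof (induction k)
      case (Suc k)
      have a1: "1 \<le> cmod a" and a0: "a \<noteq> 0" using X_ge_1[OF a] by auto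
      let ?u = "ceval (S k) a - ceval B a * inverse a ^ k"
      have "ceval (S (Suc k)) a - ceval B a * inverse a ^ Suc k = (?u - of_int (dig (S k))) / a"
        using a0 by (simp add: S_Suc *(4)[OF a] field_simps)
      then have "cmod (ceval (S (Suc k)) a - ceval B a * inverse a ^ Suc k)
          = cmod (?u - of_int (dig (S k))) / cmod a"
        by (simp add: norm_divide)
      also have "\<dots> \<le> cmod (?u - of_int (dig (S k))) / 1"
        using a1 by (intro divide_left_mono) auto
      also have "\<dots> \<le> cmod ?u + \<bar>real_of_int (dig (S k))\<bar>"
        using norm_triangle_ineq4[of ?u "of_int (dig (S k))"] by simp
      also have "\<dots> \<le> 2 * p * k + 2 * p"
        using Suc *(2)[of "S k"] by linarith
      finally show ?case by (simp add: algebra_simps)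
    qed (simp add: S_Suc)
    have tr_S: "cmod (\<Sum>b\<in>X. ceval B b * inverse b ^ k) \<le> cmod (tr (S k)) + n * (2 * p * n)"
      if k: "k < n" for k
    proof -
      have "cmod (tr (S k) - (\<Sum>b\<in>X. ceval B b * inverse b ^ k))
          = cmod (\<Sum>b\<in>X. ceval (S k) b - ceval B b * inverse b ^ k)"
        by (simp add: tr_def sum_subtractf)
      also have "\<dots> \<le> (\<Sum>b\<in>X. real_of_int (2 * p * n))"
      proof (rule sum_norm_le)
        fix b assume "b \<in> X"
        from dev[OF this, of k] have "cmod (ceval (S k) b - ceval B b * inverse b ^ k) \<le> 2 * p * k" .
        also have "\<dots> \<le> 2 * p * n" using k p_ge_1 by simp
        finally show "cmod (ceval (S k) b - ceval B b * inverse b ^ k) \<le> 2 * p * n" .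
      qed
      also have "\<dots> = n * (2 * p * n)" by (simp add: n_def)
      finally show ?thesis
        using norm_triangle_sub[of "\<Sum>b\<in>X. ceval B b * inverse b ^ k" "tr (S k)"]
        by (simp add: norm_minus_commute)
    qed
    \<comment> \<open>Otherwise all \<open>n\<close> squares are at most \<open>(C * E)^2\<close>,
      against \<open>big\<close>.\<close>
    have "\<exists>a\<in>X. C * E < cmod (ceval B a)"
    proof (rule ccontr)
      assume "\<not> ?thesis"
      then have "lyap B \<le> (\<Sum>a\<in>X. (C * E)\<^sup>2)"
        unfolding lyap_def by (intro sum_mono power_mono) (auto simp: not_less)
      then show False using big by (simp add: n_def)
    qed
    then obtain a where a: "a \<in> X" "C * E < cmod (ceval B a)" by blast
    have "C * E < C * (\<Sum>k<n. cmod (\<Sum>b\<in>X. ceval B b * inverse b ^ k))"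
      using a(2) C(2)[rule_format, OF a(1), of "ceval B"] by linarith
    then have "E < (\<Sum>k<n. cmod (\<Sum>b\<in>X. ceval B b * inverse b ^ k))" using C(1) by simp
    also have "\<dots> \<le> (\<Sum>k<n. cmod (tr (S k)) + n * (2 * p * n))"
      using tr_S by (intro sum_mono) auto
    also have "\<dots> = (\<Sum>k<n. cmod (tr (S k))) + n * (n * (2 * p * n))" by (simp add: sum.distrib)
    finally have "lyap (S n) \<le> lyap B - 1" using lyap_S[of n] unfolding E_def by linarith
    then show "\<exists>k B'. reaches k B B' \<and> (\<forall>j\<ge>degree P. coeff B' j = 0) \<and> lyap B' \<le> lyap B - 1"
      using reach low_S by blast
  qed
qed

lemma lyap_nonneg: "0 \<le> lyap B"
  unfolding lyap_def by (simp add: sum_nonneg)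

lemma reaches_bounded_lyap:
  obtains V where "\<And>B. \<exists>k B'. reaches k B B' \<and> (\<forall>j\<ge>degree P. coeff B' j = 0) \<and> lyap B' \<le> V"
proof -
  obtain V where V: "\<And>B. (\<And>j. j \<ge> degree P \<Longrightarrow> coeff B j = 0) \<Longrightarrow> V < lyap B \<Longrightarrow>
    \<exists>k B'. reaches k B B' \<and> (\<forall>j\<ge>degree P. coeff B' j = 0) \<and> lyap B' \<le> lyap B - 1"
    using lyap_decreases by blast
  have low: "\<exists>k B'. reaches k B B' \<and> (\<forall>j\<ge>degree P. coeff B' j = 0) \<and> lyap B' \<le> V"
    if "\<forall>j\<ge>degree P. coeff B j = 0" for B
    using that
  \<comment> \<open>A decrease by at least 1 between nonnegative reals strictly lowers the integer
    part, so the descent terminates.\<close>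
  proof (induction "nat \<lfloor>lyap B\<rfloor>" arbitrary: B rule: less_induct)
    case less
    show ?case
    proof (cases "V < lyap B")
      case False
      then show ?thesis using less.prems reaches_refl by force
    next
      case True
      then obtain k B' where B': "reaches k B B'" "\<forall>j\<ge>degree P. coeff B' j = 0"
        "lyap B' \<le> lyap B - 1"
        using V less.prems by blast
      then have "nat \<lfloor>lyap B'\<rfloor> < nat \<lfloor>lyap B\<rfloor>" using lyap_nonneg[of B'] by linarith
      then show ?thesis using less.hyps B'(2) reaches_trans[OF B'(1)] by blast
    qed
  qed
  show ?thesis
  proof (rule that)
    fix B
    obtain k B' where "reaches k B B'" "\<forall>j\<ge>degree P. coeff B' j = 0"
      using reduce_degree by blast
    then show "\<exists>k B'. reaches k B B' \<and> (\<forall>j\<ge>degree P. coeff B' j = 0) \<and> lyap B' \<le> V"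
      using low reaches_trans by blast
  qed
qed

lemma height_reducible: "height_reducible P"
proof -
  obtain V where V: "\<And>B. \<exists>k B'. reaches k B B' \<and> (\<forall>j\<ge>degree P. coeff B' j = 0) \<and> lyap B' \<le> V"
    using reaches_bounded_lyap by blast
  obtain C where C: "C \<ge> 0" "\<forall>B. (\<forall>j\<ge>card X. coeff B j = 0) \<longrightarrow>
    (\<forall>k. cmod (coeff B k) \<le> C * (\<Sum>a\<in>X. cmod (poly B a)))"
    using coeff_bound_by_values[OF finite_X] by blast
  define H where "H = \<lceil>C * (\<Sum>a\<in>X. 1 + V)\<rceil>"
  have "\<exists>B. P dvd (A - B) \<and> (\<forall>k. \<bar>coeff B k\<bar> \<le> 2 * p + H)" for A
  proof -
    obtain k B where B: "reaches k A B" "\<forall>j\<ge>degree P. coeff B j = 0" "lyap B \<le> V" using V by blast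
    obtain R where R: "P dvd (A - (R + monom 1 k * B))" "\<And>j. \<bar>coeff R j\<bar> \<le> 2 * p"
      using B(1) unfolding reaches_def by blast
    have val: "cmod (ceval B a) \<le> 1 + V" if "a \<in> X" for a
    proof -
      have "(cmod (ceval B a))\<^sup>2 \<le> lyap B"
        unfolding lyap_def using that finite_X
        by (intro member_le_sum[of a X "\<lambda>a. (cmod (ceval B a))\<^sup>2"]) auto
      \<comment> \<open>With \<open>t\<close> the modulus, \<open>(t - 1)^2 \<ge> 0\<close> gives
        \<open>2 * t \<le> 1 + t^2\<close>, and \<open>t \<ge> 0\<close>.\<close>
      moreover have "cmod (ceval B a) \<le> 1 + (cmod (ceval B a))\<^sup>2"
        using zero_le_power2[of "cmod (ceval B a) - 1"] norm_ge_zero[of "ceval B a"]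
        unfolding power2_diff power_one by linarith
      ultimately show ?thesis using B(3) by linarith
    qed
    have B_le: "\<bar>coeff B j\<bar> \<le> H" for j
    proof -
      have "cmod (coeff (map_poly of_int B) j) \<le> C * (\<Sum>a\<in>X. cmod (poly (map_poly of_int B) a))"
        by (rule C(2)[rule_format]) (use B(2) in \<open>simp add: coeff_map_poly card_X\<close>)
      also have "\<dots> \<le> C * (\<Sum>a\<in>X. 1 + V)"
        using val C(1) unfolding ceval_def by (intro mult_left_mono sum_mono) auto
      finally have "\<bar>real_of_int (coeff B j)\<bar> \<le> C * (\<Sum>a\<in>X. 1 + V)"
        by (simp add: coeff_map_poly)
      then show ?thesis unfolding H_def by linarith
    qed
    have "\<bar>coeff (R + monom 1 k * B) j\<bar> \<le> 2 * p + H" for j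
      using R(2)[of j] B_le[of "j - k"] by (auto simp: coeff_monom_mult)
    then show ?thesis using R(1) by blast
  qed
  then show ?thesis unfolding height_reducible_def by blast
qed

end

section \<open>Reduction of multiple roots to simple ones\<close>

lemma degree_nonzero_if_root:
  assumes "ceval B a = 0" "B \<noteq> 0"
  shows "degree B \<noteq> 0"
proof
  assume "degree B = 0"
  then obtain c where "B = [:c:]" by (rule degree_eq_zeroE)
  then show False using assms by simp
qed

text \<open>Pseudo-division stays within integer polynomials at the cost of the factor
  \<open>c\<close>, a power of the leading coefficient of \<open>M\<close>. The remainder vanishes
  at \<open>a\<close>, so minimality of \<open>M\<close> makes it 0.\<close>

lemma minimal_polynomial_pseudo_dvd:
  assumes "P \<noteq> 0" "ceval P a = 0"
  obtains c M Q where "c \<noteq> 0" "smult c P = M * Q" "ceval M a = 0" "M \<noteq> 0"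
    "\<forall>N. N \<noteq> 0 \<longrightarrow> ceval N a = 0 \<longrightarrow> degree M \<le> degree N"
proof -
  define M where "M = arg_min degree (\<lambda>N. N \<noteq> 0 \<and> ceval N a = 0)"
  have M: "M \<noteq> 0" "ceval M a = 0"
    using arg_min_natI[of "\<lambda>N. N \<noteq> 0 \<and> ceval N a = 0" P degree] assms by (auto simp: M_def)
  have min: "degree M \<le> degree N" if "N \<noteq> 0" "ceval N a = 0" for N
    using arg_min_nat_le[of "\<lambda>N. N \<noteq> 0 \<and> ceval N a = 0" N degree] that by (auto simp: M_def)
  obtain Q R where QR: "pseudo_divmod P M = (Q, R)" by fastforce
  define c where "c = coeff M (degree M) ^ (Suc (degree P) - degree M)"
  have eq: "smult c P = M * Q + R" and R: "R = 0 \<or> degree R < degree M"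
    using pseudo_divmod[OF M(1) QR] by (auto simp: c_def)
  have "ceval R a = 0"
    using arg_cong[OF eq, of "\<lambda>B. ceval B a"] assms M by simp
  then have "R = 0" using R min[of R] by (meson not_le)
  then show ?thesis using that[of c M Q] eq M min by (auto simp: c_def)
qed

lemma no_small_root_imp_height_reducible:
  assumes "P \<noteq> 0" "\<And>a. ceval P a = 0 \<Longrightarrow> 1 \<le> cmod a"
  shows "height_reducible P"
  using assms
proof (induction "degree P" arbitrary: P rule: less_induct)
  case less
  let ?P = "map_poly complex_of_int P"
  have P0: "?P \<noteq> 0" using less.prems by (simp add: map_poly_of_int_eq_0_iff)
  show ?case
  proof (cases "rsquarefree ?P")
    case True
    then have "smult (lead_coeff ?P) (\<Prod>a | ceval P a = 0. [:- a, 1:]) = ?P"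
      unfolding ceval_def by (rule complex_poly_decompose_rsquarefree)
    then have "degree ?P = degree (\<Prod>a | ceval P a = 0. [:- a, 1:])"
      using P0 by (metis degree_smult_eq leading_coeff_0_iff)
    then have "card {a. ceval P a = 0} = degree P"
      by (simp add: degree_prod_eq_sum_degree degree_map_poly_of_int)
    then interpret simple_roots P "{a. ceval P a = 0}"
      by unfold_locales (use less.prems in auto)
    show ?thesis by (rule height_reducible)
  next
    case False
    then obtain a where a: "ceval P a = 0" "ceval (pderiv P) a = 0"
      by (auto simp: rsquarefree_roots ceval_def pderiv_map_poly_of_int)
    obtain c M Q where *: "c \<noteq> 0" "smult c P = M * Q" "ceval M a = 0" "M \<noteq> 0"
      "\<forall>N. N \<noteq> 0 \<longrightarrow> ceval N a = 0 \<longrightarrow> degree M \<le> degree N"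
      using minimal_polynomial_pseudo_dvd[OF less.prems(1) a(1)] by blast
    have "degree P \<noteq> 0"
      using a(1) less.prems(1) by (rule degree_nonzero_if_root)
    \<comment> \<open>The derivative is a nonzero competitor of smaller degree vanishing at the
      multiple root \<open>a\<close>.\<close>
    then have "degree M < degree P"
      using *(5)[rule_format, of "pderiv P"] a(2) by (simp add: pderiv_eq_0_iff degree_pderiv)
    moreover have "degree M \<noteq> 0"
      using *(3,4) by (rule degree_nonzero_if_root)
    moreover have Q0: "Q \<noteq> 0" using * less.prems(1) by auto
    moreover have "degree P = degree M + degree Q"
      using arg_cong[OF *(2), of degree] *(1,4) Q0 by (simp add: degree_mult_eq)
    ultimately have deg: "degree M < degree P" "degree Q < degree P" by auto
    \<comment> \<open>As \<open>c\<close> is nonzero, the factors have no roots beyond those of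
      \<open>P\<close> and inherit the bound on the roots.\<close>
    have roots: "ceval P b = 0" if "ceval M b = 0 \<or> ceval Q b = 0" for b
      using arg_cong[OF *(2), of "\<lambda>B. ceval B b"] that *(1) by auto
    have "height_reducible M" "height_reducible Q"
      by (rule less.hyps; use deg *(4) Q0 roots less.prems(2) in blast)+
    then have "height_reducible (smult c P)" using *(2) height_reducible_mult by simp
    then show ?thesis by (rule height_reducible_dvd) (simp add: dvd_smult)
  qed
qed

theorem theorem2:
  fixes P :: "int poly"
  shows "(\<exists>N :: int set. finite N \<and>
            (UNIV :: int poly set) = polys_over N + principal_ideal P)
     \<longleftrightarrow> \<not> (\<exists>\<alpha> :: complex. poly (map_poly of_int P) \<alpha> = 0 \<and> cmod \<alpha> < 1)"
    (is "?L \<longleftrightarrow> ?R")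
proof
  assume ?L
  then show ?R using polys_over_imp_no_small_root unfolding ceval_def by blast
next
  assume ?R
  then have roots: "1 \<le> cmod a" if "ceval P a = 0" for a
    using that by (force simp: ceval_def)
  \<comment> \<open>The zero polynomial would have the root 0.\<close>
  have "P \<noteq> 0" using roots[of 0] by auto
  then show ?L
    using roots height_reducible_imp_polys_over no_small_root_imp_height_reducible by blast
qed

end
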